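(* For every bipartite graph $G$ there is an integer $d\ge 1$ such that $G$, regarded as a simplicial complex of dimension at most $1$, is $d$-Tverberg.
   Context: All graphs are finite and simple. Given a finite set $S\subset\mathbb{R}^d$ and a partition $P=(S_1,\dots,S_m)$ of $S$ into nonempty parts, the nerve $\mathcal{N}(P)$ is the simplicial complex on vertex set $\{1,\dots,m\}$ whose faces are the $I\subset\{1,\dots,m\}$ with $\bigcap_{i\in I}\operatorname{conv}(S_i)\neq\emptyset$. A simplicial complex $\mathcal{K}$ is $d$-Tverberg if there is a constant $N$ such that for every finite point set $S\subset\mathbb{R}^d$ with at least $N$ points there is a partition $P$ of $S$ with $\mathcal{N}(P)$ isomorphic to $\mathcal{K}$. A graph is regarded as the simplicial complex whose faces are its vertices and edges.
   Formalization: d-Tverberg is taken over finite point sets in general position (every at most d+1 points affinely independent), not all finite point sets: for collinear sets nerves have interval graphs as 1-skeleton, so the 4-cycle would be a counterexample. Graphs are assumed nonempty. *)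

theory Defs
  imports "HOL-Analysis.Analysis" "HOL-Library.Function_Algebras"
begin

(* The dimension d is existentially quantified inside the statement, so R^d cannot be a type
   indexed by d. It is the subspace of nat => real of the functions vanishing from index d on.
   With the pointwise vector space structure, the library's hulls are available, and for a subset
   of this subspace they are its hulls inside R^d. *)

instantiation "fun" :: (type, real_vector) real_vector
begin

definition scaleR_fun :: "real \<Rightarrow> ('a \<Rightarrow> 'b) \<Rightarrow> 'a \<Rightarrow> 'b" where
  "scaleR_fun r f = (\<lambda>x. r *\<^sub>R f x)"

instance
  by standard (auto simp: scaleR_fun_def plus_fun_def fun_eq_iff scaleR_add_right scaleR_add_left)

end

definition euclidean_coords :: "nat \<Rightarrow> (nat \<Rightarrow> real) set" where
  "euclidean_coords d = {x. \<forall>i\<ge>d. x i = 0}"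

definition general_position :: "nat \<Rightarrow> (nat \<Rightarrow> real) set \<Rightarrow> bool" where
  "general_position d S \<longleftrightarrow> (\<forall>T\<subseteq>S. finite T \<and> card T \<le> d + 1 \<longrightarrow> \<not> affine_dependent T)"

(* A simplicial complex is represented by the set of its nonempty faces; its vertex set is the
   union of the faces. *)

definition complex_iso :: "'a set set \<Rightarrow> 'b set set \<Rightarrow> bool" where
  "complex_iso K L \<longleftrightarrow> (\<exists>f. bij_betw f (\<Union>K) (\<Union>L) \<and> (\<lambda>\<sigma>. f ` \<sigma>) ` K = L)"

definition indexed_partition :: "nat \<Rightarrow> (nat \<Rightarrow> 'a set) \<Rightarrow> 'a set \<Rightarrow> bool" where
  "indexed_partition m P S \<longleftrightarrow>
     (\<forall>i\<in>{1..m}. P i \<noteq> {}) \<and> disjoint_family_on P {1..m} \<and> (\<Union>i\<in>{1..m}. P i) = S"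

definition partition_nerve :: "nat \<Rightarrow> (nat \<Rightarrow> 'a::real_vector set) \<Rightarrow> nat set set" where
  "partition_nerve m P = {I. I \<noteq> {} \<and> I \<subseteq> {1..m} \<and> (\<Inter>i\<in>I. convex hull (P i)) \<noteq> {}}"

(* General position is essential. The parts of a set of collinear points span intervals, so their
   nerve has an interval graph as 1-skeleton; if S could be collinear, the 4-cycle, which is not
   an interval graph, would be d-Tverberg for no d. *)

definition tverberg_complex :: "nat \<Rightarrow> 'a set set \<Rightarrow> bool" where
  "tverberg_complex d K \<longleftrightarrow>
     (\<exists>N. \<forall>S. finite S \<and> S \<subseteq> euclidean_coords d \<and> general_position d S \<and> card S \<ge> N \<longrightarrow>
        (\<exists>m P. indexed_partition m P S \<and> complex_iso (partition_nerve m P) K))"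

(* Graphs are nonempty: a nonempty point set has no partition into zero parts, so the empty
   complex is d-Tverberg for no d. *)

definition simple_graph :: "'a set \<Rightarrow> 'a set set \<Rightarrow> bool" where
  "simple_graph V E \<longleftrightarrow> finite V \<and> V \<noteq> {} \<and> (\<forall>e\<in>E. e \<subseteq> V \<and> card e = 2)"

definition bipartite :: "'a set \<Rightarrow> 'a set set \<Rightarrow> bool" where
  "bipartite V E \<longleftrightarrow>
     (\<exists>A B. A \<union> B = V \<and> A \<inter> B = {} \<and> (\<forall>e\<in>E. \<exists>a\<in>A. \<exists>b\<in>B. e = {a, b}))"

definition graph_complex :: "'a set \<Rightarrow> 'a set set \<Rightarrow> 'a set set" where
  "graph_complex V E = (\<lambda>v. {v}) ` V \<union> E"

end

(* For d = 2^|V|, every large set S in general position in R^d admits |V| hyperplanes such that each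
   of the 2^|V| sign cells contains d + 2 points of S: by Ramsey, S has a long sequence all of whose
   (d+1)-tuples are equally oriented, as on the moment curve, and a hyperplane through d of its points
   is crossed by the sequence at exactly these points.

   Let A, B be the colour classes and H_v the halfspaces. Each point x goes to the first a in A with
   x in H_a (to the last a if there is none), which makes the hulls of the parts of A disjoint and uses
   up all of S. For an edge ab, a Radon partition of d + 2 points in a suitable cell of the region of a
   moves some of its points to b so that the hulls of a and b meet. The cells are chosen such that
   H_b separates b from the rest of B, and such that the part of b avoids H_i for each
   non-neighbour i. The last a has no halfspace; if it is not a neighbour of b, it is separated from b
   by H_t for the last neighbour t of b. *)

theory Submission
  imports Defs "HOL-Library.Ramsey" "Jordan_Normal_Form.Determinant"
begin

section \<open>Radon partitions in R^d, viewed as a space of functions\<close>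

lemma sum_fun_eval: "(\<Sum>i\<in>I. f i) x = (\<Sum>i\<in>I. (f i x :: real))"
  by (induction I rule: infinite_finite_induct) (auto simp: zero_fun_def plus_fun_def)

lemma euclidean_coords_subset_span:
  "euclidean_coords d \<subseteq> span ((\<lambda>r i. if i = r then 1 else 0) ` {..<d})"
proof
  fix x :: "nat \<Rightarrow> real" assume x: "x \<in> euclidean_coords d"
  let ?e = "\<lambda>r i. if i = r then 1 else (0::real)"
  have "x = (\<Sum>r<d. x r *\<^sub>R ?e r)"
    using x by (auto simp: fun_eq_iff sum_fun_eval scaleR_fun_def euclidean_coords_def if_distrib cong: if_cong)
  moreover have "(\<Sum>r<d. x r *\<^sub>R ?e r) \<in> span (?e ` {..<d})"
    by (intro span_sum span_scale span_base) auto
  ultimately show "x \<in> span (?e ` {..<d})" by metis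
qed

text \<open>Translating one point to the origin leaves \<open>d + 1\<close> differences in the span
  of \<open>d\<close> unit vectors.\<close>

lemma affine_dependent_if_card_gt:
  assumes "Q \<subseteq> euclidean_coords d" "card Q = d + 2"
  shows "affine_dependent Q"
proof -
  let ?e = "\<lambda>r i. if i = r then 1 else (0::real)"
  have "Q \<noteq> {}" and fin: "finite Q" using assms(2) by (auto intro: card_ge_0_finite)
  then obtain a where a: "a \<in> Q" by blast
  let ?R = "(\<lambda>x. -a + x) ` (Q - {a})"
  have "card ?R = card (Q - {a})" by (rule card_image) (simp add: inj_on_def)
  then have card: "card ?R = d + 1" using assms(2) a fin by simp
  have "?R \<subseteq> euclidean_coords d"
  proof
    fix y assume "y \<in> ?R"
    then obtain x where "x \<in> Q" "y = -a + x" by blast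
    moreover from this have "x \<in> euclidean_coords d" "a \<in> euclidean_coords d"
      using assms(1) a by auto
    ultimately show "y \<in> euclidean_coords d" by (auto simp: euclidean_coords_def plus_fun_def fun_Compl_def)
  qed
  then have "?R \<subseteq> span (?e ` {..<d})" using euclidean_coords_subset_span[of d] by (rule order_trans)
  moreover have "card (?e ` {..<d}) \<le> d" using card_image_le[of "{..<d}" ?e] by simp
  ultimately have "dependent ?R"
    using independent_span_bound[of "?e ` {..<d}" ?R] card by auto
  then show ?thesis using affine_dependent_iff_dependent2[OF a] by simp
qed

lemma Radon_partition_coords:
  assumes "Q \<subseteq> euclidean_coords d" "card Q = d + 2"
  obtains M P where "M \<inter> P = {}" "M \<union> P = Q" "convex hull M \<inter> convex hull P \<noteq> {}"
  \<comment> \<open>An infinite \<open>Q\<close> would have \<open>card Q = 0\<close>, so the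
    cardinality gives finiteness as well.\<close>
  using Radon_partition[of Q] affine_dependent_if_card_gt[OF assms] assms(2)
  by (metis card.infinite add_eq_0_iff_both_eq_0 zero_neq_numeral)

section \<open>Orientations of (d+1)-tuples of points\<close>

text \<open>The columns are the points \<open>p x\<close> for \<open>x\<close> in \<open>X\<close>,
  in increasing order of \<open>x\<close>, each extended by a last coordinate 1. For
  \<open>card X = d + 1\<close> the sign is the orientation of this tuple.\<close>

definition orient :: "nat \<Rightarrow> (nat \<Rightarrow> nat \<Rightarrow> real) \<Rightarrow> nat set \<Rightarrow> real" where
  "orient d p X = Determinant.det (Matrix.mat (d + 1) (d + 1)
     (\<lambda>(r, c). if r < d then p (sorted_list_of_set X ! c) r else 1))"

text \<open>A kernel vector of a singular matrix is an affine dependence: the row of ones makes its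
  entries sum to 0, and the other rows make the weighted sum of the points vanish.\<close>

lemma orient_nonzero:
  assumes X: "card X = d + 1" and inj: "inj_on p X" and p: "p ` X \<subseteq> euclidean_coords d"
    and indep: "\<not> affine_dependent (p ` X)"
  shows "orient d p X \<noteq> 0"
proof
  assume "orient d p X = 0"
  let ?xs = "sorted_list_of_set X"
  let ?f = "\<lambda>(r, c). if r < d then p (?xs ! c) r else 1 :: real"
  let ?M = "Matrix.mat (d + 1) (d + 1) ?f"
  let ?g = "\<lambda>c. p (?xs ! c)"
  have fin: "finite X" using X by (auto intro: card_ge_0_finite)
  have len: "length ?xs = d + 1" using X by simp
  have xs: "bij_betw ((!) ?xs) {..<d + 1} X"
    using bij_betw_nth[of ?xs "{..<d + 1}" X] fin len by simp
  have g: "bij_betw ?g {..<d + 1} (p ` X)"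
    using bij_betw_trans[OF xs inj_on_imp_bij_betw[OF inj]] by (simp add: comp_def)
  have "Determinant.det ?M = 0" using \<open>orient d p X = 0\<close> by (simp add: orient_def)
  then obtain v where v: "v \<in> carrier_vec (d + 1)" "v \<noteq> 0\<^sub>v (d + 1)" "?M *\<^sub>v v = 0\<^sub>v (d + 1)"
    using det_0_iff_vec_prod_zero[of ?M "d + 1"] by auto
  have row: "(\<Sum>c<d + 1. ?f (r, c) * vec_index v c) = 0" if "r < d + 1" for r
  proof -
    have "vec_index (?M *\<^sub>v v) r = (\<Sum>c<d + 1. ?f (r, c) * vec_index v c)"
      using that v(1) by (auto simp: scalar_prod_def lessThan_atLeast0 intro!: sum.cong)
    moreover have "vec_index (?M *\<^sub>v v) r = 0"
      unfolding v(3) using that by (rule index_zero_vec)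
    ultimately show ?thesis by (rule trans[OF sym])
  qed
  \<comment> \<open>Moves the coefficients from columns to points, which is unambiguous because
    \<open>?g\<close> is injective.\<close>
  define U where "U = (\<lambda>x. vec_index v (the_inv_into {..<d + 1} ?g x))"
  have U: "U (?g c) = vec_index v c" if "c < d + 1" for c
    using the_inv_into_f_f[of ?g "{..<d + 1}" c] g that by (simp add: U_def bij_betw_def)
  have "sum U (p ` X) = (\<Sum>c<d + 1. vec_index v c)"
    using sum.reindex_bij_betw[OF g, of U] U by simp
  then have s0: "sum U (p ` X) = 0" using row[of d] by simp
  have "(\<Sum>x\<in>p ` X. U x *\<^sub>R x) = (\<Sum>c<d + 1. vec_index v c *\<^sub>R ?g c)"
    using sum.reindex_bij_betw[OF g, of "\<lambda>x. U x *\<^sub>R x"] U by simp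
  moreover have "(\<Sum>c<d + 1. vec_index v c *\<^sub>R ?g c) r = 0" for r
  proof (cases "r < d")
    case True
    then show ?thesis using row[of r] by (simp add: sum_fun_eval scaleR_fun_def mult.commute)
  next
    case False
    have "?g c r = 0" if "c < d + 1" for c
    proof -
      have "?g c \<in> p ` X" using that xs by (auto simp: bij_betw_def)
      then show ?thesis using p False by (auto simp: euclidean_coords_def)
    qed
    then show ?thesis by (simp add: sum_fun_eval scaleR_fun_def)
  qed
  ultimately have s1: "(\<Sum>x\<in>p ` X. U x *\<^sub>R x) = 0" by (auto simp: fun_eq_iff)
  obtain c where c: "c < d + 1" "vec_index v c \<noteq> 0"
    using v(1,2) by (metis carrier_vecD eq_vecI index_zero_vec(1,2))
  have "?g c \<in> p ` X" using g c(1) by (auto simp: bij_betw_def)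
  moreover have "U (?g c) \<noteq> 0" using U c by simp
  ultimately have "affine_dependent (p ` X)"
    using s0 s1 fin by (subst affine_dependent_explicit_finite) blast+
  with indep show False by simp
qed

text \<open>Locates the column of \<open>x\<close> in the matrix of
  \<open>orient d p (insert x D)\<close>; the other columns keep the order they have for
  \<open>D\<close>.\<close>

lemma nth_sorted_list_of_set_insert:
  fixes D :: "nat set"
  assumes "finite D" "x \<notin> D" "c \<le> card D"
  defines "j \<equiv> card {m \<in> D. m < x}"
  shows "sorted_list_of_set (insert x D) ! c =
    (if c < j then sorted_list_of_set D ! c else if c = j then x else sorted_list_of_set D ! (c - 1))"
proof -
  let ?l = "sorted_list_of_set {m \<in> D. m < x}" and ?g = "sorted_list_of_set {m \<in> D. x < m}"
  have split: "{m \<in> D. m < x} \<union> {m \<in> D. x < m} = D" using assms(2) nat_neq_iff by blast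
  have D: "sorted_list_of_set D = ?l @ ?g"
    using assms(1,2) by (intro sorted_distinct_set_unique) (auto simp: sorted_append split)
  have "sorted_list_of_set (insert x D) = ?l @ x # ?g"
    using assms(1,2) by (intro sorted_distinct_set_unique) (auto simp: sorted_append sorted_insort distinct_insort set_insort_key)
  moreover have "length ?l = j" by (simp add: j_def)
  ultimately show ?thesis unfolding D by (auto simp: nth_append nth_Cons')
qed

text \<open>Laplace expansion along the column of \<open>x\<close>: the minors involve only points
  of \<open>D\<close>, so \<open>x\<close> enters through an affine function of \<open>p x\<close>
  and, by its column number, through a sign. If all orientations agree, the affine function thus
  changes sign each time \<open>x\<close> passes an element of \<open>D\<close>.\<close>

lemma orient_insert:
  assumes D: "finite D" "card D = d"
  obtains a where "\<And>x. x \<notin> D \<Longrightarrow>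
    orient d p (insert x D) = (-1) ^ card {m \<in> D. m < x} * ((\<Sum>r<d. a r * p x r) + a d)"
proof
  let ?ds = "sorted_list_of_set D"
  \<comment> \<open>\<open>?E r\<close> is the minor without row \<open>r\<close>:
    \<open>insert_index r\<close> skips that row, and original index \<open>d\<close> is still the
    row of ones.\<close>
  let ?E = "\<lambda>r. Matrix.mat d d (\<lambda>(r', c). if insert_index r r' < d then p (?ds ! c) (insert_index r r') else 1)"
  let ?a = "\<lambda>r. (-1) ^ r * Determinant.det (?E r)"
  fix x assume x: "x \<notin> D"
  let ?xs = "sorted_list_of_set (insert x D)"
  define j where "j = card {m \<in> D. m < x}"
  have j: "j \<le> d" unfolding j_def D(2)[symmetric] using D(1) by (intro card_mono) auto
  let ?M = "Matrix.mat (d + 1) (d + 1) (\<lambda>(r, c). if r < d then p (?xs ! c) r else 1 :: real)"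
  have nth: "?xs ! c = (if c < j then ?ds ! c else if c = j then x else ?ds ! (c - 1))" if "c \<le> d" for c
    using nth_sorted_list_of_set_insert[OF D(1) x, of c] that D(2) by (simp add: j_def)
  have cof: "cofactor ?M r j = (-1) ^ j * ?a r" if "r < d + 1" for r
  proof -
    have "mat_delete ?M r j = ?E r"
      using that j nth by (intro eq_matI) (auto simp: mat_delete_def insert_index_def)
    then show ?thesis by (simp add: cofactor_def power_add)
  qed
  have "orient d p (insert x D) = (\<Sum>r<d + 1. index_mat ?M (r, j) * cofactor ?M r j)"
    unfolding orient_def using j by (intro laplace_expansion_column) auto
  also have "\<dots> = (\<Sum>r<d + 1. (if r < d then p x r else 1) * ((-1) ^ j * ?a r))"
    using j cof nth[OF j] by (intro sum.cong) (auto simp del: index_mat simp: index_mat(1))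
  also have "\<dots> = (-1) ^ j * ((\<Sum>r<d. ?a r * p x r) + ?a d)"
    by (simp add: sum_distrib_left algebra_simps)
  finally show "orient d p (insert x D) = (-1) ^ card {m \<in> D. m < x} * ((\<Sum>r<d. ?a r * p x r) + ?a d)"
    by (simp add: j_def)
qed

text \<open>A strictly increasing reindexing keeps the order of the columns, so orientations pass to
  subsequences.\<close>

lemma orient_comp_strict_mono:
  assumes "finite X" "strict_mono_on X h" "card X = d + 1"
  shows "orient d p (h ` X) = orient d (p \<circ> h) X"
proof -
  let ?xs = "sorted_list_of_set X"
  have "sorted_list_of_set (h ` X) = map h ?xs"
  proof (rule sorted_distinct_set_unique)
    have "sorted_wrt (<) ?xs" by simp
    then have "sorted_wrt (<) (map h ?xs)"
      unfolding sorted_wrt_map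
      by (rule sorted_wrt_mono_rel[rotated]) (use assms(1,2) in \<open>auto simp: strict_mono_on_def\<close>)
    then show "sorted (map h ?xs)" "distinct (map h ?xs)"
      by (auto simp: strict_sorted_iff)
  qed (use assms in auto)
  then have "sorted_list_of_set (h ` X) ! c = h (?xs ! c)" if "c < d + 1" for c
    using that \<open>card X = d + 1\<close> by simp
  then show ?thesis
    unfolding orient_def by (intro arg_cong[where f = Determinant.det] cong_mat) auto
qed

section \<open>Equally oriented sequences by Ramsey's theorem\<close>

text \<open>Ramsey's theorem is applied to the (d+1)-subsets of an enumeration of \<open>S\<close>,
  coloured by the sign of their orientation; \<open>\<epsilon>\<close> records the common
  sign.\<close>

lemma homogeneous_sequence:
  obtains N where "\<And>S. finite S \<Longrightarrow> S \<subseteq> euclidean_coords d \<Longrightarrow> general_position d S \<Longrightarrow> card S \<ge> N \<Longrightarrow>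
    \<exists>q \<epsilon>. inj_on q {..<L} \<and> q ` {..<L} \<subseteq> S \<and> (\<forall>X\<subseteq>{..<L}. card X = d + 1 \<longrightarrow> \<epsilon> * orient d q X > 0)"
proof -
  obtain N :: nat where N: "partn_lst {..<N} [L, L] (d + 1)" using ramsey_full by blast
  show thesis
  proof (rule that)
    fix S assume S: "finite S" "S \<subseteq> euclidean_coords d" "general_position d S" "card S \<ge> N"
    obtain p where p: "bij_betw p {..<card S} S"
      using ex_bij_betw_nat_finite[OF S(1)] by (auto simp: lessThan_atLeast0)
    \<comment> \<open>Colour 1 means a nonpositive determinant; general position later excludes
      0.\<close>
    let ?f = "\<lambda>X. if orient d p X > 0 then 0 else 1 :: nat"
    have "?f \<in> nsets {..<N} (d + 1) \<rightarrow> {..<length [L, L]}" by simp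
    then obtain i where i: "i < length [L, L]" "monochromatic {..<N} ([L, L] ! i) (d + 1) ?f i"
      using N unfolding partn_lst_def by blast
    moreover from i(1) have "[L, L] ! i = L" by (auto simp: less_Suc_eq)
    ultimately obtain H where H: "H \<subseteq> {..<N}" "card H = L" "?f ` nsets H (d + 1) \<subseteq> {i}"
      unfolding monochromatic_def nsets_def by auto
    define h where "h = (!) (sorted_list_of_set H)"
    have fin: "finite H" using H(1) finite_subset by blast
    have h: "strict_mono_on {..<L} h"
      using sorted_wrt_nth_less[of "(<)" "sorted_list_of_set H"] H(2)
      by (auto simp: strict_mono_on_def h_def)
    have hH: "h ` {..<L} = H"
      using bij_betw_nth[of "sorted_list_of_set H" "{..<L}" H] fin H(2) by (auto simp: h_def bij_betw_def)
    have inj_h: "inj_on h {..<L}" using h by (rule strict_mono_on_imp_inj_on)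
    have pH: "inj_on p H" "p ` H \<subseteq> S"
    proof -
      have "H \<subseteq> {..<card S}" using H(1) S(4) by auto
      then show "inj_on p H" "p ` H \<subseteq> S" using p by (auto simp: bij_betw_def intro: inj_on_subset)
    qed
    have "(if i = 0 then 1 else -1) * orient d (p \<circ> h) X > 0" if X: "X \<subseteq> {..<L}" "card X = d + 1" for X
    proof -
      have finX: "finite X" using X(1) finite_subset by blast
      have hX: "h ` X \<subseteq> H" "card (h ` X) = d + 1"
        using X hH card_image[OF inj_on_subset[OF inj_h X(1)]] by auto
      then have "?f (h ` X) = i" using H(3) finX by (auto simp: nsets_def image_subset_iff)
      moreover have "p ` h ` X \<subseteq> S" using hX(1) pH(2) by blast
      then have "\<not> affine_dependent (p ` h ` X)"
        using S(3) finX hX(2) unfolding general_position_def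
        by (metis card_image_le finite_imageI)
      then have "orient d p (h ` X) \<noteq> 0"
        using hX pH S(2) \<open>p ` h ` X \<subseteq> S\<close> by (intro orient_nonzero) (auto intro: inj_on_subset)
      moreover have "orient d p (h ` X) = orient d (p \<circ> h) X"
        using X finX h by (intro orient_comp_strict_mono) (auto intro: monotone_on_subset)
      ultimately show ?thesis by (auto split: if_splits)
    qed
    moreover have "inj_on (p \<circ> h) {..<L}" using inj_h pH(1) hH by (auto intro: comp_inj_on)
    moreover have "(p \<circ> h) ` {..<L} \<subseteq> S" using pH(2) hH by (auto simp: image_comp)
    ultimately show "\<exists>q \<epsilon>. inj_on q {..<L} \<and> q ` {..<L} \<subseteq> S \<and> (\<forall>X\<subseteq>{..<L}. card X = d + 1 \<longrightarrow> \<epsilon> * orient d q X > 0)"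
      by blast
  qed
qed

section \<open>Halfspaces with prescribed sign patterns\<close>

text \<open>The complement is included because separation is always expressed by a convex set with
  convex complement.\<close>

lemma convex_affine_side:
  fixes a :: "nat \<Rightarrow> real"
  shows "convex {y. (\<Sum>r<d. a r * y r) + b < 0}" "convex (- {y. (\<Sum>r<d. a r * y r) + b < 0})"
proof -
  let ?h = "\<lambda>y. (\<Sum>r<d. a r * y r) + b"
  have h: "?h (u *\<^sub>R x + v *\<^sub>R y) = u * ?h x + v * ?h y" if "u + v = 1" for u v :: real and x y
  proof -
    have "b = u * b + v * b" using that by (simp flip: distrib_right)
    then show ?thesis
      by (simp add: plus_fun_def scaleR_fun_def algebra_simps sum.distrib sum_distrib_left)
  qed
  show "convex {y. ?h y < 0}"
    unfolding convex_def mem_Collect_eq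
  proof (intro ballI allI impI)
    fix x y and u v :: real
    assume "x \<in> {y. ?h y < 0}" "y \<in> {y. ?h y < 0}" "0 \<le> u" "0 \<le> v" "u + v = 1"
    then show "?h (u *\<^sub>R x + v *\<^sub>R y) < 0"
      unfolding h[OF \<open>u + v = 1\<close>] using convex_bound_lt[of "?h x" 0 "?h y" u v] by simp
  qed
  show "convex (- {y. ?h y < 0})"
    unfolding convex_def Compl_iff mem_Collect_eq not_less
  proof (intro ballI allI impI)
    fix x y and u v :: real
    assume "x \<in> - {y. ?h y < 0}" "y \<in> - {y. ?h y < 0}" "0 \<le> u" "0 \<le> v" "u + v = 1"
    then show "0 \<le> ?h (u *\<^sub>R x + v *\<^sub>R y)"
      unfolding h[OF \<open>u + v = 1\<close>] by simp
  qed
qed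

text \<open>The counted \<open>t\<close> are the changes of \<open>\<tau>\<close>, whose value
  before 0 is taken to be \<open>False\<close>; every change flips the value.\<close>

lemma parity_card_changes:
  fixes \<tau> :: "nat \<Rightarrow> bool"
  shows "odd (card {t. t \<le> s \<and> \<tau> t \<noteq> (0 < t \<and> \<tau> (t - 1))}) \<longleftrightarrow> \<tau> s"
proof (induction s)
  case 0
  have "{t. t \<le> 0 \<and> \<tau> t \<noteq> (0 < t \<and> \<tau> (t - 1))} = (if \<tau> 0 then {0} else {})" by auto
  then show ?case by simp
next
  case (Suc s)
  let ?C = "\<lambda>s. {t. t \<le> s \<and> \<tau> t \<noteq> (0 < t \<and> \<tau> (t - 1))}"
  have "?C (Suc s) = (if \<tau> (Suc s) \<noteq> \<tau> s then insert (Suc s) (?C s) else ?C s)"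
    by (auto simp: le_Suc_eq)
  moreover have "finite (?C s)" "Suc s \<notin> ?C s" by auto
  ultimately show ?case using Suc by auto
qed

text \<open>The sequence consists of \<open>d\<close> fillers and then \<open>K\<close> blocks, each
  a separator followed by \<open>w\<close> points. A hyperplane is put through \<open>d\<close>
  members of the sequence: the separators where \<open>\<tau>\<close> changes, and enough fillers.
  By \<open>orient_insert\<close> its side is constant on the \<open>w\<close> points of a block and
  switches exactly when \<open>\<tau>\<close> does.\<close>

lemma alternating_halfspace:
  fixes q :: "nat \<Rightarrow> nat \<Rightarrow> real" and \<tau> :: "nat \<Rightarrow> bool"
  assumes hom: "\<And>X. X \<subseteq> {..<d + K * (w + 1)} \<Longrightarrow> card X = d + 1 \<Longrightarrow> \<epsilon> * orient d q X > 0"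
    and K: "K \<le> d"
  obtains H where "convex H" "convex (- H)"
    "\<And>s i. s < K \<Longrightarrow> i < w \<Longrightarrow> q (d + s * (w + 1) + 1 + i) \<in> H \<longleftrightarrow> \<tau> s"
proof -
  define C where "C = {t. t < K \<and> \<tau> t \<noteq> (0 < t \<and> \<tau> (t - 1))}"
  define sep where "sep = (\<lambda>s. d + s * (w + 1))"
  \<comment> \<open>There are at most \<open>K \<le> d\<close> changes; initial fillers pad the
    chosen separators to exactly \<open>d\<close> indices.\<close>
  define D where "D = {..<d - card C} \<union> sep ` C"
  have finC: "finite C" by (simp add: C_def)
  have CK: "card C \<le> K" using card_mono[of "{..<K}" C] by (auto simp: C_def)
  have inj: "inj_on sep Y" for Y by (rule inj_onI) (simp add: sep_def del: mult_Suc_right)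
  have finD: "finite D" using finC by (simp add: D_def)
  have card_part: "card ({..<d - card C} \<union> sep ` Y) = d - card C + card Y" if "finite Y" for Y
  proof -
    have "{..<d - card C} \<inter> sep ` Y = {}" by (auto simp: sep_def)
    then show ?thesis using that by (simp add: card_Un_disjoint card_image[OF inj])
  qed
  have cardD: "card D = d" using card_part[OF finC] CK K by (simp add: D_def)
  obtain a where a: "\<And>x. x \<notin> D \<Longrightarrow>
      orient d q (insert x D) = (-1) ^ card {m \<in> D. m < x} * ((\<Sum>r<d. a r * q x r) + a d)"
    using orient_insert[OF finD cardD, of q] by blast
  \<comment> \<open>\<open>c\<close> absorbs \<open>\<epsilon>\<close> and the sign contributed by
    the fillers, so on block \<open>s\<close> only the parity of the chosen separators up to
    \<open>s\<close> remains.\<close>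
  define c where "c = \<epsilon> * (-1) ^ (d - card C)"
  define H where "H = {y. (\<Sum>r<d. c * a r * y r) + c * a d < 0}"
  have "q (sep s + 1 + i) \<in> H \<longleftrightarrow> \<tau> s" if s: "s < K" and i: "i < w" for s i
  proof -
    let ?x = "sep s + 1 + i"
    let ?n = "card {t \<in> C. t \<le> s}"
    let ?h = "(\<Sum>r<d. a r * q ?x r) + a d"
    have lt: "sep t < ?x \<longleftrightarrow> t \<le> s" and neq: "sep t \<noteq> ?x" for t
    proof -
      have "sep t \<le> sep s" if "t \<le> s"
        unfolding sep_def using that by (intro add_left_mono mult_le_mono1)
      moreover have "?x < sep t" if "s < t"
      proof -
        have "sep (Suc s) \<le> sep t" unfolding sep_def using that by (intro add_left_mono mult_le_mono1) simp
        then show ?thesis using i by (simp add: sep_def)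
      qed
      ultimately show "sep t < ?x \<longleftrightarrow> t \<le> s" "sep t \<noteq> ?x" by (cases "t \<le> s"; force)+
    qed
    have bound: "sep t < d + K * (w + 1)" if "t < K" for t
      unfolding sep_def using that by (intro add_strict_left_mono mult_strict_right_mono) simp_all
    have filler: "m < ?x" if "m < d - card C" for m using that by (simp add: sep_def)
    have "?x \<notin> sep ` C" using neq by (metis imageE)
    moreover have "?x \<notin> {..<d - card C}" using filler[of ?x] by blast
    ultimately have xnD: "?x \<notin> D" unfolding D_def by blast
    have "Suc s * (w + 1) \<le> K * (w + 1)" using s by (intro mult_le_mono1) simp
    then have "?x < d + K * (w + 1)" using i by (simp add: sep_def)
    then have sub: "insert ?x D \<subseteq> {..<d + K * (w + 1)}"
      using bound by (auto simp: D_def C_def)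
    have "card (insert ?x D) = d + 1" using xnD finD cardD by simp
    then have pos: "\<epsilon> * orient d q (insert ?x D) > 0" using hom sub by blast
    \<comment> \<open>Every chosen filler precedes the point, as do exactly the chosen separators of
      blocks up to \<open>s\<close>.\<close>
    have "{m \<in> D. m < ?x} = {..<d - card C} \<union> sep ` {t \<in> C. t \<le> s}"
      using lt filler by (auto simp: D_def)
    then have "card {m \<in> D. m < ?x} = d - card C + ?n" using card_part[of "{t \<in> C. t \<le> s}"] finC by simp
    then have pos': "(-1) ^ ?n * (c * ?h) > 0"
      using pos a[OF xnD] by (simp add: c_def power_add algebra_simps)
    have "{t \<in> C. t \<le> s} = {t. t \<le> s \<and> \<tau> t \<noteq> (0 < t \<and> \<tau> (t - 1))}"
      using s by (auto simp: C_def)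
    then have "odd ?n \<longleftrightarrow> \<tau> s" using parity_card_changes[of s \<tau>] by simp
    then have "c * ?h < 0 \<longleftrightarrow> \<tau> s" using pos' by (cases "odd ?n") auto
    then show ?thesis by (simp add: H_def sum_distrib_left algebra_simps)
  qed
  then show thesis using convex_affine_side that[of H] by (simp add: H_def sep_def)
qed

text \<open>All halfspaces are built from the same blocks of one homogeneous sequence, with one
  block for each subset of \<open>I\<close>, so every pattern occurs. A block has
  \<open>d + 2\<close> points in order to carry a Radon partition.\<close>

lemma rich_cells:
  fixes I :: "'i set"
  assumes "finite I"
  obtains d N where "d \<ge> 1"
    "\<And>S. finite S \<Longrightarrow> S \<subseteq> euclidean_coords d \<Longrightarrow> general_position d S \<Longrightarrow> card S \<ge> N \<Longrightarrow>
      \<exists>H. (\<forall>i\<in>I. convex (H i) \<and> convex (- H i)) \<and>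
        (\<forall>F\<subseteq>I. \<exists>Q\<subseteq>S. card Q = d + 2 \<and> (\<forall>x\<in>Q. {i \<in> I. x \<in> H i} = F))"
proof -
  \<comment> \<open>One block per subset of \<open>I\<close> makes \<open>2 ^ card I\<close> blocks,
    and \<open>alternating_halfspace\<close> handles at most \<open>d\<close> of them.\<close>
  define d :: nat where "d = 2 ^ card I"
  let ?L = "d + d * (d + 2 + 1)"
  obtain N where N: "\<And>S. finite S \<Longrightarrow> S \<subseteq> euclidean_coords d \<Longrightarrow> general_position d S \<Longrightarrow> card S \<ge> N \<Longrightarrow>
    \<exists>q \<epsilon>. inj_on q {..<?L} \<and> q ` {..<?L} \<subseteq> S \<and> (\<forall>X\<subseteq>{..<?L}. card X = d + 1 \<longrightarrow> \<epsilon> * orient d q X > 0)"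
    using homogeneous_sequence[of d ?L] by metis
  show thesis
  proof (rule that)
    show "d \<ge> 1" by (simp add: d_def)
    fix S assume S: "finite S" "S \<subseteq> euclidean_coords d" "general_position d S" "card S \<ge> N"
    obtain q \<epsilon> where q: "inj_on q {..<?L}" "q ` {..<?L} \<subseteq> S"
      and hom: "\<And>X. X \<subseteq> {..<?L} \<Longrightarrow> card X = d + 1 \<Longrightarrow> \<epsilon> * orient d q X > 0"
      using N[OF S] by metis
    obtain e where e: "bij_betw e {..<d} (Pow I)"
      using ex_bij_betw_nat_finite[of "Pow I"] assms by (auto simp: lessThan_atLeast0 card_Pow d_def)
    let ?pos = "\<lambda>s k. d + s * (d + 2 + 1) + 1 + k"
    \<comment> \<open>For the index \<open>i\<close>, the side prescribed on block \<open>s\<close>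
      is whether \<open>i\<close> belongs to the subset \<open>e s\<close>.\<close>
    have "\<exists>H. convex H \<and> convex (- H) \<and> (\<forall>s<d. \<forall>k<d + 2. q (?pos s k) \<in> H \<longleftrightarrow> i \<in> e s)" for i
      by (rule alternating_halfspace[OF hom order_refl, where \<tau> = "\<lambda>s. i \<in> e s"]) blast+
    then obtain H where H: "\<And>i. convex (H i) \<and> convex (- H i)"
      "\<And>i s k. s < d \<Longrightarrow> k < d + 2 \<Longrightarrow> q (?pos s k) \<in> H i \<longleftrightarrow> i \<in> e s"
      by metis
    have "\<exists>Q\<subseteq>S. card Q = d + 2 \<and> (\<forall>x\<in>Q. {i \<in> I. x \<in> H i} = F)" if F: "F \<subseteq> I" for F
    proof -
      obtain s where s: "s < d" "e s = F"
        using e F by (metis PowI bij_betw_imp_surj_on imageE lessThan_iff)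
      let ?Q = "(q \<circ> ?pos s) ` {..<d + 2}"
      have "Suc s * (d + 2 + 1) \<le> d * (d + 2 + 1)" using s(1) by (intro mult_le_mono1) simp
      then have pos: "?pos s ` {..<d + 2} \<subseteq> {..<?L}" by auto
      have "inj_on (q \<circ> ?pos s) {..<d + 2}"
        using inj_on_subset[OF q(1) pos] by (intro comp_inj_on) (auto simp: inj_on_def)
      then have "card ?Q = d + 2" by (simp only: card_image card_lessThan)
      moreover have "?Q \<subseteq> S" using q(2) pos unfolding image_comp[symmetric] by blast
      moreover have "{i \<in> I. x \<in> H i} = F" if "x \<in> ?Q" for x
        using that H(2)[OF s(1)] s(2) F by auto
      ultimately show ?thesis by blast
    qed
    then show "\<exists>H. (\<forall>i\<in>I. convex (H i) \<and> convex (- H i)) \<and>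
        (\<forall>F\<subseteq>I. \<exists>Q\<subseteq>S. card Q = d + 2 \<and> (\<forall>x\<in>Q. {i \<in> I. x \<in> H i} = F))"
      using H(1) by blast
  qed
qed

section \<open>Parts whose hulls intersect as a bipartite graph prescribes\<close>

lemma convex_hulls_disjoint:
  assumes "convex C" "convex (- C)" "X \<subseteq> C" "Y \<subseteq> - C"
  shows "convex hull X \<inter> convex hull Y = {}"
  using hull_minimal[of X C convex] hull_minimal[of Y "- C" convex] assms by blast

text \<open>The combinatorial core, in any real vector space. \<open>N j\<close> is the
  neighbourhood of \<open>j\<close>, nonempty so that \<open>j\<close> receives points at all;
  \<open>cells\<close> supplies a Radon partition inside every sign cell.\<close>

lemma bipartite_hull_pattern:
  fixes A B :: "'v set" and S :: "'a::real_vector set"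
  assumes fin: "finite A" and A: "A \<noteq> {}" and AB: "A \<inter> B = {}"
    and N: "\<And>j. j \<in> B \<Longrightarrow> N j \<subseteq> A \<and> N j \<noteq> {}"
    and H: "\<And>i. i \<in> A \<union> B \<Longrightarrow> convex (H i) \<and> convex (- H i)"
    and cells: "\<And>F. F \<subseteq> A \<union> B \<Longrightarrow> \<exists>M P. M \<inter> P = {} \<and> M \<union> P \<subseteq> S \<and>
      convex hull M \<inter> convex hull P \<noteq> {} \<and> (\<forall>x\<in>M \<union> P. {i \<in> A \<union> B. x \<in> H i} = F)"
  obtains P where "\<And>v. v \<in> A \<union> B \<Longrightarrow> P v \<noteq> {}" "disjoint_family_on P (A \<union> B)" "(\<Union>v\<in>A \<union> B. P v) = S"
    "\<And>i k. i \<in> A \<Longrightarrow> k \<in> A \<Longrightarrow> i \<noteq> k \<Longrightarrow> convex hull (P i) \<inter> convex hull (P k) = {}"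
    "\<And>i k. i \<in> B \<Longrightarrow> k \<in> B \<Longrightarrow> i \<noteq> k \<Longrightarrow> convex hull (P i) \<inter> convex hull (P k) = {}"
    "\<And>k j. k \<in> A \<Longrightarrow> j \<in> B \<Longrightarrow> convex hull (P k) \<inter> convex hull (P j) \<noteq> {} \<longleftrightarrow> k \<in> N j"
proof -
  define radon where "radon F M Q \<longleftrightarrow> M \<inter> Q = {} \<and> M \<union> Q \<subseteq> S \<and>
    convex hull M \<inter> convex hull Q \<noteq> {} \<and> (\<forall>x\<in>M \<union> Q. {i \<in> A \<union> B. x \<in> H i} = F)" for F M Q
  have "\<exists>M Q. radon F M Q" if "F \<subseteq> A \<union> B" for F
    using cells[OF that] by (simp only: radon_def)
  then obtain M Q where "\<And>F. F \<subseteq> A \<union> B \<Longrightarrow> radon F (M F) (Q F)" by metis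
  then have MQ: "M F \<inter> Q F = {}" and MQ_S: "M F \<union> Q F \<subseteq> S"
    and meet: "convex hull (M F) \<inter> convex hull (Q F) \<noteq> {}"
    and pat: "x \<in> M F \<union> Q F \<Longrightarrow> {i \<in> A \<union> B. x \<in> H i} = F" if "F \<subseteq> A \<union> B" for F x
    using that unfolding radon_def by blast+
  \<comment> \<open>An arbitrary linear order on \<open>A\<close>, to which "first" and "last"
    refer.\<close>
  obtain r :: "'v \<Rightarrow> nat" where r: "inj_on r A"
    using finite_imp_inj_to_nat_seg[OF fin] by blast
  have max_elem: "\<exists>l\<in>X. \<forall>i\<in>X. r i \<le> r l" if "X \<subseteq> A" "X \<noteq> {}" for X
  proof -
    have "finite (r ` X)" using that fin finite_subset by blast
    then have "Max (r ` X) \<in> r ` X" "\<forall>i\<in>X. r i \<le> Max (r ` X)" using that by auto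
    then show ?thesis by (metis imageE)
  qed
  obtain l where l: "l \<in> A" "\<And>i. i \<in> A \<Longrightarrow> r i \<le> r l" using max_elem[of A] A by auto
  have "\<exists>l\<in>N j. \<forall>i\<in>N j. r i \<le> r l" if "j \<in> B" for j
    using max_elem[of "N j"] N[OF that] by blast
  then obtain top where top: "\<And>j. j \<in> B \<Longrightarrow> top j \<in> N j" "\<And>j i. j \<in> B \<Longrightarrow> i \<in> N j \<Longrightarrow> r i \<le> r (top j)"
    by metis
  \<comment> \<open>The last vertex \<open>l\<close> accepts every point, so the regions
    \<open>R\<close> cover the whole space.\<close>
  define G where "G i = (if i = l then UNIV else H i)" for i
  define R where "R k = {x. x \<in> G k \<and> (\<forall>i\<in>A. r i < r k \<longrightarrow> x \<notin> G i)}" for k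
  have G: "convex (G i)" "convex (- G i)" if "i \<in> A" for i
    using H that by (auto simp: G_def)
  have R_cover: "\<exists>k\<in>A. x \<in> R k" for x
  proof -
    have "l \<in> A \<and> x \<in> G l" using l(1) by (simp add: G_def)
    from ex_has_least_nat[of "\<lambda>k. k \<in> A \<and> x \<in> G k", OF this, of r]
    show ?thesis by (fastforce simp: R_def not_less[symmetric])
  qed
  have in_R: "x \<in> R k" if "{i \<in> A \<union> B. x \<in> H i} = F" "k \<in> A" "k \<in> F" "\<And>i. i \<in> A \<Longrightarrow> i \<in> F \<Longrightarrow> r k \<le> r i" for x F k
  proof -
    have "x \<notin> G i" if i: "i \<in> A" "r i < r k" for i
    proof -
      \<comment> \<open>\<open>l\<close> comes last, so it never precedes \<open>k\<close>; away
        from \<open>l\<close>, \<open>G\<close> agrees with \<open>H\<close>.\<close>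
      have "i \<noteq> l" using l(2)[OF \<open>k \<in> A\<close>] i by auto
      moreover have "i \<notin> F" using that(2) \<open>\<And>i. i \<in> A \<Longrightarrow> i \<in> F \<Longrightarrow> r k \<le> r i\<close>[OF i(1)] by auto
      ultimately show ?thesis using \<open>{i \<in> A \<union> B. x \<in> H i} = F\<close> i(1) by (auto simp: G_def)
    qed
    then show ?thesis using that(1,3) by (auto simp: R_def G_def)
  qed
  \<comment> \<open>The cell used for the edge between \<open>k\<close> and \<open>j\<close>: its
    first element of \<open>A\<close> is \<open>k\<close>, so it lies in \<open>R k\<close>; it
    contains \<open>top j\<close>, but no non-neighbour of \<open>j\<close> and no other vertex of
    \<open>B\<close>.\<close>
  define F where "F j k = insert j {i \<in> N j. r k \<le> r i}" for j k
  have F_sub: "F j k \<subseteq> A \<union> B" if "j \<in> B" for j k using that N by (auto simp: F_def)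
  define Pb where "Pb j = (\<Union>k\<in>N j. M (F j k))" for j
  define Pa where "Pa k = S \<inter> R k - (\<Union>j\<in>B. Pb j)" for k
  define P where "P v = (if v \<in> A then Pa v else Pb v)" for v
  have P_A: "P k = Pa k" if "k \<in> A" for k using that by (simp add: P_def)
  have P_B: "P j = Pb j" if "j \<in> B" for j using that AB by (auto simp: P_def)
  have Pb_pat: "\<exists>k\<in>N j. \<forall>i\<in>A \<union> B. x \<in> H i \<longleftrightarrow> i \<in> F j k" if "j \<in> B" "x \<in> Pb j" for j x
  proof -
    obtain k where "k \<in> N j" "x \<in> M (F j k)" using \<open>x \<in> Pb j\<close> by (auto simp: Pb_def)
    moreover from this have "{i \<in> A \<union> B. x \<in> H i} = F j k" using pat[OF F_sub[OF \<open>j \<in> B\<close>]] by blast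
    ultimately show ?thesis by blast
  qed
  have Pb_own: "Pb j \<subseteq> H j" if "j \<in> B" for j
    using Pb_pat[OF that] that unfolding F_def by blast
  have Pb_top: "Pb j \<subseteq> H (top j)" if j: "j \<in> B" for j
  proof
    fix x assume "x \<in> Pb j"
    then obtain k where k: "k \<in> N j" "\<forall>i\<in>A \<union> B. x \<in> H i \<longleftrightarrow> i \<in> F j k" using Pb_pat[OF j] by blast
    moreover have "top j \<in> F j k" using top(1)[OF j] top(2)[OF j k(1)] by (simp add: F_def)
    ultimately show "x \<in> H (top j)" using F_sub[OF j] by blast
  qed
  have Pb_other: "Pb j \<subseteq> - H i" if "j \<in> B" "i \<in> A \<union> B" "i \<noteq> j" "i \<notin> N j" for i j
    using Pb_pat[OF that(1)] that(2-) unfolding F_def by blast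
  have Q_Pa: "Q (F j k) \<subseteq> Pa k" if j: "j \<in> B" and k: "k \<in> N j" for j k
  proof
    fix x assume x: "x \<in> Q (F j k)"
    have pat_x: "{i \<in> A \<union> B. x \<in> H i} = F j k" using pat[OF F_sub[OF j]] x by blast
    have kA: "k \<in> A" using N j k by blast
    have "x \<in> S" using MQ_S[OF F_sub[OF j]] x by blast
    moreover have "x \<in> R k"
      using pat_x kA by (rule in_R) (use AB j k in \<open>auto simp: F_def\<close>)
    moreover have "x \<notin> Pb j'" if j': "j' \<in> B" for j'
    proof
      assume "x \<in> Pb j'"
      then obtain k' where k': "k' \<in> N j'" "x \<in> M (F j' k')" by (auto simp: Pb_def)
      \<comment> \<open>The pattern determines the edge: \<open>j\<close> is its only element in
        \<open>B\<close> and \<open>k\<close> its first in \<open>A\<close>. So \<open>x\<close>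
        would lie in both halves of one Radon partition.\<close>
      have eq: "F j k = F j' k'" using pat[OF F_sub[OF j']] k'(2) pat_x by blast
      moreover have "j \<notin> N j'" using N j j' AB by blast
      ultimately have "j = j'" by (auto simp: F_def)
      have "j \<notin> N j" using N j AB by blast
      then have "k \<in> F j' k'" "k' \<in> F j k" using eq k k'(1) \<open>j = j'\<close> by (auto simp: F_def)
      then have "r k = r k'" using kA N[OF j] k k'(1) \<open>j = j'\<close> \<open>j \<notin> N j\<close> by (auto simp: F_def)
      then have "k = k'" using r kA N[OF j'] k'(1) by (auto dest: inj_onD)
      then show False using MQ[OF F_sub[OF j]] x k'(2) \<open>j = j'\<close> by blast
    qed
    ultimately show "x \<in> Pa k" by (auto simp: Pa_def)
  qed
  have nonempty: "P v \<noteq> {}" if "v \<in> A \<union> B" for v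
  proof (cases "v \<in> A")
    case True
    \<comment> \<open>The cell with pattern \<open>{v}\<close> is nonempty because its Radon hulls
      meet, and it lies outside every \<open>H j\<close> with \<open>j\<close> in \<open>B\<close>,
      so no \<open>Pb j\<close> takes points from it.\<close>
    then have v: "{v} \<subseteq> A \<union> B" by blast
    obtain x where x: "x \<in> M {v}" using meet[OF v] by force
    have pat_x: "{i \<in> A \<union> B. x \<in> H i} = {v}" using pat[OF v] x by blast
    have "x \<in> R v" using pat_x True by (rule in_R) auto
    moreover have "x \<in> S" using MQ_S[OF v] x by blast
    moreover have "x \<notin> Pb j" if "j \<in> B" for j
      using Pb_own[OF that] pat_x that True AB by blast
    ultimately show ?thesis using P_A[OF True] by (auto simp: Pa_def)
  next
    case False
    then have v: "v \<in> B" using that by blast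
    then obtain k where "k \<in> N v" using N by blast
    moreover have "M (F v k) \<noteq> {}" using meet[OF F_sub[OF v, of k]] by force
    ultimately show ?thesis using P_B[OF v] by (auto simp: Pb_def)
  qed
  \<comment> \<open>\<open>G i\<close> contains the region of \<open>i\<close> and misses every
    later region.\<close>
  have disj_less: "convex hull (P i) \<inter> convex hull (P k) = {}" if "i \<in> A" "k \<in> A" "r i < r k" for i k
    by (rule convex_hulls_disjoint[OF G[OF \<open>i \<in> A\<close>]]) (use that in \<open>auto simp: P_A Pa_def R_def\<close>)
  have disj_A: "convex hull (P i) \<inter> convex hull (P k) = {}" if "i \<in> A" "k \<in> A" "i \<noteq> k" for i k
  proof -
    have "r i \<noteq> r k" using r that by (auto dest: inj_onD)
    then show ?thesis using disj_less[of i k] disj_less[of k i] that by (auto simp: nat_neq_iff)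
  qed
  have disj_B: "convex hull (P i) \<inter> convex hull (P k) = {}" if "i \<in> B" "k \<in> B" "i \<noteq> k" for i k
  proof (rule convex_hulls_disjoint)
    have "i \<notin> N k" using N that AB by blast
    then show "P k \<subseteq> - H i" using Pb_other[of k i] that P_B by auto
  qed (use H Pb_own P_B that in auto)
  have edge: "convex hull (P k) \<inter> convex hull (P j) \<noteq> {} \<longleftrightarrow> k \<in> N j" if k: "k \<in> A" and j: "j \<in> B" for k j
  proof
    assume kN: "k \<in> N j"
    have "convex hull (Q (F j k)) \<subseteq> convex hull (P k)"
      using Q_Pa[OF j kN] P_A[OF k] by (intro hull_mono) simp
    moreover have "convex hull (M (F j k)) \<subseteq> convex hull (P j)"
      using kN P_B[OF j] by (intro hull_mono) (auto simp: Pb_def)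
    ultimately show "convex hull (P k) \<inter> convex hull (P j) \<noteq> {}" using meet[OF F_sub[OF j, of k]] by blast
  next
    assume ne: "convex hull (P k) \<inter> convex hull (P j) \<noteq> {}"
    show "k \<in> N j"
    proof (rule ccontr)
      assume kN: "k \<notin> N j"
      \<comment> \<open>For \<open>k \<noteq> l\<close> the halfspace \<open>H k\<close> separates.
        For \<open>k = l\<close>, \<open>top j\<close> precedes \<open>l\<close>, so the region of
        \<open>l\<close> misses \<open>H (top j)\<close>, which contains the part of
        \<open>j\<close>.\<close>
      have "\<exists>C. convex C \<and> convex (- C) \<and> (P k \<subseteq> C \<and> P j \<subseteq> - C \<or> P j \<subseteq> C \<and> P k \<subseteq> - C)"
      proof (cases "k = l")
        case True
        have t: "top j \<in> A" "top j \<noteq> l" using top(1)[OF j] N[OF j] kN True by auto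
        then have "r (top j) < r l" using l r by (metis inj_onD le_neq_implies_less)
        then have "P k \<subseteq> - H (top j)"
          using t P_A[OF k] True by (auto simp: Pa_def R_def G_def)
        then show ?thesis using Pb_top[OF j] P_B[OF j] H t(1) by blast
      next
        case False
        then have "P k \<subseteq> H k" using P_A[OF k] by (auto simp: Pa_def R_def G_def)
        moreover have "P j \<subseteq> - H k" using Pb_other[OF j, of k] k j kN AB P_B[OF j] by blast
        ultimately show ?thesis using H k by blast
      qed
      then show False using ne convex_hulls_disjoint by (metis inf_commute)
    qed
  qed
  have "disjoint_family_on P (A \<union> B)"
    unfolding disjoint_family_on_def
  proof (intro ballI impI)
    \<comment> \<open>Parts within one class are disjoint because their hulls are; across the
      classes, \<open>Pa\<close> removes all \<open>Pb\<close> by definition.\<close>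
    have hull: "P v \<subseteq> convex hull (P v)" for v by (rule hull_subset)
    have AB_disj: "P k \<inter> P j = {}" if "k \<in> A" "j \<in> B" for k j
      using that by (auto simp: P_A P_B Pa_def)
    fix v w assume "v \<in> A \<union> B" "w \<in> A \<union> B" "v \<noteq> w"
    then show "P v \<inter> P w = {}"
      using disj_A[of v w] disj_B[of v w] AB_disj[of v w] AB_disj[of w v] hull[of v] hull[of w] by blast
  qed
  moreover have "(\<Union>v\<in>A \<union> B. P v) = S"
  proof
    show "(\<Union>v\<in>A \<union> B. P v) \<subseteq> S"
      using MQ_S[OF F_sub] by (auto simp: P_def Pa_def Pb_def split: if_splits)
    show "S \<subseteq> (\<Union>v\<in>A \<union> B. P v)"
    proof
      fix x assume "x \<in> S"
      then show "x \<in> (\<Union>v\<in>A \<union> B. P v)"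
        using R_cover[of x] P_A P_B by (cases "\<exists>j\<in>B. x \<in> Pb j") (auto simp: Pa_def)
    qed
  qed
  ultimately show thesis using that[of P] nonempty disj_A disj_B edge by blast
qed

section \<open>From the hull pattern to the nerve\<close>

text \<open>The numbering \<open>f\<close> of the vertices is itself the isomorphism; nonempty parts
  make every singleton a face, so the nerve uses all of \<open>{1..m}\<close>.\<close>

lemma complex_iso_partition_nerve:
  assumes f: "bij_betw f {1..m} V" and K: "\<Union>K = V" "{} \<notin> K"
    and nerve: "\<And>J. J \<subseteq> V \<Longrightarrow> J \<noteq> {} \<Longrightarrow> (\<Inter>v\<in>J. convex hull (P v)) \<noteq> {} \<longleftrightarrow> J \<in> K"
    and nonempty: "\<And>v. v \<in> V \<Longrightarrow> P v \<noteq> {}"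
  shows "complex_iso (partition_nerve m (P \<circ> f)) K"
  unfolding complex_iso_def
proof (intro exI conjI)
  let ?N = "partition_nerve m (P \<circ> f)"
  have fV: "f ` {1..m} = V" using f by (simp add: bij_betw_def)
  have in_nerve: "I \<in> ?N \<longleftrightarrow> I \<subseteq> {1..m} \<and> f ` I \<in> K" for I
  proof (cases "I \<noteq> {} \<and> I \<subseteq> {1..m}")
    case True
    then have "f ` I \<subseteq> V" "f ` I \<noteq> {}" using fV by auto
    from nerve[OF this] True show ?thesis by (simp add: partition_nerve_def image_comp)
  next
    case False
    then show ?thesis using K(2) by (auto simp: partition_nerve_def)
  qed
  have "{i} \<in> ?N" if "i \<in> {1..m}" for i
    using that nonempty fV by (auto simp: partition_nerve_def)
  then have "\<Union>?N = {1..m}" by (fastforce simp: in_nerve)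
  then show "bij_betw f (\<Union>?N) (\<Union>K)" using f K(1) by simp
  have "J \<in> (\<lambda>\<sigma>. f ` \<sigma>) ` ?N" if "J \<in> K" for J
  proof -
    have "J \<subseteq> f ` {1..m}" using that K(1) fV by blast
    then obtain I where "I \<subseteq> {1..m}" "J = f ` I" by (meson subset_imageE)
    then show ?thesis using that in_nerve by blast
  qed
  then show "(\<lambda>\<sigma>. f ` \<sigma>) ` ?N = K" using in_nerve by blast
qed

theorem theorem6:
  fixes V :: "'a set" and E :: "'a set set"
  assumes "simple_graph V E" and "bipartite V E"
  shows "\<exists>d\<ge>1. tverberg_complex d (graph_complex V E)"
proof -
  have finV: "finite V" and V: "V \<noteq> {}" and E: "\<And>e. e \<in> E \<Longrightarrow> e \<subseteq> V \<and> card e = 2"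
    using assms(1) by (auto simp: simple_graph_def)
  obtain A0 B0 where AB0: "A0 \<union> B0 = V" "A0 \<inter> B0 = {}"
    and edge0: "\<And>e. e \<in> E \<Longrightarrow> \<exists>a\<in>A0. \<exists>b\<in>B0. e = {a, b}"
    using assms(2) by (auto simp: bipartite_def)
  \<comment> \<open>Isolated vertices go to the side whose parts have whole regions of their own.\<close>
  define B where "B = {b \<in> B0. \<exists>a\<in>A0. {a, b} \<in> E}"
  define A where "A = V - B"
  define N where "N j = {k. {k, j} \<in> E}" for j
  have AB: "A \<union> B = V" "A \<inter> B = {}" using AB0 by (auto simp: A_def B_def)
  have A0A: "A0 \<subseteq> A" using AB0 by (auto simp: A_def B_def)
  have edge: "\<exists>a\<in>A. \<exists>b\<in>B. e = {a, b}" if "e \<in> E" for e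
  proof -
    obtain a b where "a \<in> A0" "b \<in> B0" "e = {a, b}" using edge0[OF \<open>e \<in> E\<close>] by blast
    moreover from this have "b \<in> B" using that by (auto simp: B_def)
    ultimately show ?thesis using A0A by blast
  qed
  have N: "N j \<subseteq> A \<and> N j \<noteq> {}" if "j \<in> B" for j
  proof
    show "N j \<subseteq> A"
    proof
      fix k assume "k \<in> N j"
      then obtain a b where "a \<in> A" "b \<in> B" "{k, j} = {a, b}"
        unfolding N_def using edge[of "{k, j}"] by blast
      then show "k \<in> A" using that AB(2) by (auto simp: doubleton_eq_iff)
    qed
    show "N j \<noteq> {}" using that by (auto simp: B_def N_def)
  qed
  \<comment> \<open>A vertex in \<open>B\<close> would already have a neighbour in
    \<open>A\<close>.\<close>
  have "A \<noteq> {}" using N AB(1) V by blast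
  have "finite A" using AB(1) finV by (metis finite_Un)
  obtain d L where "d \<ge> 1" and rich: "\<And>S. finite S \<Longrightarrow> S \<subseteq> euclidean_coords d \<Longrightarrow>
      general_position d S \<Longrightarrow> card S \<ge> L \<Longrightarrow>
      \<exists>H. (\<forall>i\<in>V. convex (H i) \<and> convex (- H i)) \<and>
        (\<forall>F\<subseteq>V. \<exists>Q\<subseteq>S. card Q = d + 2 \<and> (\<forall>x\<in>Q. {i \<in> V. x \<in> H i} = F))"
    by (fact rich_cells[OF finV])
  obtain f where f: "bij_betw f {1..card V} V"
    using ex_bij_betw_nat_finite_1[OF finV] by blast
  have "\<exists>m P. indexed_partition m P S \<and> complex_iso (partition_nerve m P) (graph_complex V E)"
    if S: "finite S" "S \<subseteq> euclidean_coords d" "general_position d S" "card S \<ge> L" for S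
  proof -
    obtain H where H: "\<And>i. i \<in> A \<union> B \<Longrightarrow> convex (H i) \<and> convex (- H i)"
      and cell: "\<And>F. F \<subseteq> A \<union> B \<Longrightarrow>
        \<exists>Q\<subseteq>S. card Q = d + 2 \<and> (\<forall>x\<in>Q. {i \<in> A \<union> B. x \<in> H i} = F)"
      using rich[OF S] unfolding AB(1) by metis
    have cells: "\<exists>M P. M \<inter> P = {} \<and> M \<union> P \<subseteq> S \<and> convex hull M \<inter> convex hull P \<noteq> {} \<and>
        (\<forall>x\<in>M \<union> P. {i \<in> A \<union> B. x \<in> H i} = F)" if F: "F \<subseteq> A \<union> B" for F
    proof -
      obtain Q where Q: "Q \<subseteq> S" "card Q = d + 2" "\<forall>x\<in>Q. {i \<in> A \<union> B. x \<in> H i} = F"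
        using cell[OF F] by blast
      have "Q \<subseteq> euclidean_coords d" using Q(1) S(2) by (rule order_trans)
      then obtain M P where "M \<inter> P = {}" "M \<union> P = Q" "convex hull M \<inter> convex hull P \<noteq> {}"
        using Q(2) by (rule Radon_partition_coords)
      then show ?thesis using Q by (intro exI[of _ M] exI[of _ P]) simp
    qed
    obtain P where P: "\<And>v. v \<in> A \<union> B \<Longrightarrow> P v \<noteq> {}" "disjoint_family_on P (A \<union> B)"
      "(\<Union>v\<in>A \<union> B. P v) = S"
      and disjA: "\<And>i k. i \<in> A \<Longrightarrow> k \<in> A \<Longrightarrow> i \<noteq> k \<Longrightarrow> convex hull (P i) \<inter> convex hull (P k) = {}"
      and disjB: "\<And>i k. i \<in> B \<Longrightarrow> k \<in> B \<Longrightarrow> i \<noteq> k \<Longrightarrow> convex hull (P i) \<inter> convex hull (P k) = {}"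
      and adj: "\<And>k j. k \<in> A \<Longrightarrow> j \<in> B \<Longrightarrow> convex hull (P k) \<inter> convex hull (P j) \<noteq> {} \<longleftrightarrow> k \<in> N j"
    proof -
      show thesis
        by (rule bipartite_hull_pattern[of A B N H S])
          (fact \<open>finite A\<close> \<open>A \<noteq> {}\<close> AB(2) N H cells that)+
    qed
    have nerve: "(\<Inter>v\<in>J. convex hull (P v)) \<noteq> {} \<longleftrightarrow> J \<in> graph_complex V E"
      if J: "J \<subseteq> V" "J \<noteq> {}" for J
    proof
      assume "(\<Inter>v\<in>J. convex hull (P v)) \<noteq> {}"
      then have meet: "convex hull (P v) \<inter> convex hull (P w) \<noteq> {}" if "v \<in> J" "w \<in> J" for v w
        using that by blast
      \<comment> \<open>A face has at most one vertex in each class, so it is a single vertex or a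
        pair across the classes; in particular the nerve has no triangles.\<close>
      have oneA: "v = w" if "v \<in> J \<inter> A" "w \<in> J \<inter> A" for v w using that disjA[of v w] meet[of v w] by blast
      have oneB: "v = w" if "v \<in> J \<inter> B" "w \<in> J \<inter> B" for v w using that disjB[of v w] meet[of v w] by blast
      show "J \<in> graph_complex V E"
      proof (cases "\<exists>a b. a \<in> J \<inter> A \<and> b \<in> J \<inter> B")
        case True
        then obtain a b where ab: "a \<in> J \<inter> A" "b \<in> J \<inter> B" by blast
        then have "J = {a, b}" using oneA oneB J(1) AB(1) by blast
        moreover have "{a, b} \<in> E" using adj[of a b] meet[of a b] ab by (auto simp: N_def)
        ultimately show ?thesis by (simp add: graph_complex_def)
      next
        case False
        then obtain v where "v \<in> V" "J = {v}" using oneA oneB J AB(1) by blast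
        then show ?thesis by (simp add: graph_complex_def)
      qed
    next
      assume "J \<in> graph_complex V E"
      then consider v where "v \<in> V" "J = {v}" | "J \<in> E" by (auto simp: graph_complex_def)
      then show "(\<Inter>v\<in>J. convex hull (P v)) \<noteq> {}"
      proof cases
        case 1
        then show ?thesis using P(1) AB(1) by simp
      next
        case 2
        then obtain a b where "a \<in> A" "b \<in> B" "J = {a, b}" using edge by blast
        then show ?thesis using adj[of a b] 2 by (simp add: N_def)
      qed
    qed
    have iso: "complex_iso (partition_nerve (card V) (P \<circ> f)) (graph_complex V E)"
    proof (rule complex_iso_partition_nerve[OF f])
      show "\<Union>(graph_complex V E) = V" using E by (auto simp: graph_complex_def)
      show "{} \<notin> graph_complex V E" using E[of "{}"] by (auto simp: graph_complex_def)
    qed (use nerve P(1) AB(1) in auto)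
    have "disjoint_family_on (P \<circ> f) {1..card V}"
      using P(2) f unfolding AB(1) disjoint_family_on_def bij_betw_def inj_on_def comp_def by blast
    moreover have "(\<Union>i\<in>{1..card V}. (P \<circ> f) i) = S"
      using P(3) f unfolding AB(1) by (simp add: bij_betw_def flip: image_image)
    moreover have "\<forall>i\<in>{1..card V}. (P \<circ> f) i \<noteq> {}"
      using P(1) f unfolding AB(1) by (auto simp: bij_betw_def)
    ultimately have "indexed_partition (card V) (P \<circ> f) S" by (simp add: indexed_partition_def)
    with iso show ?thesis by blast
  qed
  then have "tverberg_complex d (graph_complex V E)" unfolding tverberg_complex_def by blast
  with \<open>d \<ge> 1\<close> show ?thesis by blast
qed

end
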